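(* Let $(H,\delta)$ be a sequence of spaces and maps such that $R(\delta_p\delta_{p+1})$ is finite dimensional for each $p\in\mathbb{Z}$. Then the following statements are equivalent: (i) $(H,\delta)$ is a Fredholm chain; (ii) $\delta_{p+1}\delta_{p+1}^*+\delta_p^*\delta_p\in L(H_p)$ is a Fredholm self-adjoint operator for each $p\in\mathbb{Z}$.
   Context: $L(X,Y)$ denotes the bounded linear maps between Hilbert spaces $X$ and $Y$, $L(X)=L(X,X)$; $N(\cdot)$ and $R(\cdot)$ denote null space and range; $*$ is the Hilbert space adjoint. A sequence of spaces and maps $(H,\delta)$ consists of Hilbert spaces $H_p$ and operators $\delta_p\in L(H_p,H_{p-1})$, $p\in\mathbb{Z}$, for which there is $n\in\mathbb{N}$ such that $H_p=0$ and $\delta_p=0$ for $p<0$ and for $p\ge n+1$; i.e. $0\to H_n\xrightarrow{\delta_n}H_{n-1}\to\cdots\to H_1\xrightarrow{\delta_1}H_0\to 0$ (with no requirement that $\delta_p\delta_{p+1}=0$). It is called a Fredholm chain if $N(\delta_p)/(N(\delta_p)\cap R(\delta_{p+1}))$ and $R(\delta_{p+1})/(N(\delta_p)\cap R(\delta_{p+1}))$ are finite dimensional for every $p=0,\dots,n$. *)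

theory Defs
  imports "HOL-Analysis.Analysis"
begin

text \<open>
  Scalars. The class makes all notions below available over the reals and over the complex
  numbers at once; up to isomorphism these are its only models (Gelfand--Mazur).
\<close>

class conj_field = real_normed_field +
  fixes conj :: "'a \<Rightarrow> 'a"
  assumes conj_add: "conj (x + y) = conj x + conj y"
    and mult_conj: "x * conj x = (norm x)\<^sup>2 *\<^sub>R 1"

instantiation real :: conj_field
begin
definition conj_real :: "real \<Rightarrow> real" where "conj_real x = x"
instance by standard (simp_all add: conj_real_def power2_eq_square)
end

instantiation complex :: conj_field
begin
definition conj_complex :: "complex \<Rightarrow> complex" where "conj_complex z = cnj z"
instance
  by standard
    (simp_all add: conj_complex_def scaleR_conv_of_real complex_norm_square del: of_real_power)
end

text \<open>
  A Hilbert space structure on the type \<open>'a\<close> over the scalar field \<open>'k\<close>; completeness comes from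
  the class \<open>banach\<close>. The inner product is linear in its first argument.
\<close>

locale hilbert_space = vector_space smul
  for smul :: "'k::conj_field \<Rightarrow> 'a::banach \<Rightarrow> 'a" +
  fixes ip :: "'a \<Rightarrow> 'a \<Rightarrow> 'k"
  assumes smul_of_real: "smul (of_real r) x = r *\<^sub>R x"
    and ip_add_left: "ip (x + y) z = ip x z + ip y z"
    and ip_smul_left: "ip (smul c x) y = c * ip x y"
    and ip_conj: "ip y x = conj (ip x y)"
    and ip_self: "ip x x = of_real ((norm x)\<^sup>2)"

lemma hilbert_space_real_inner:
  "hilbert_space scaleR (inner :: 'a::{real_inner,banach} \<Rightarrow> 'a \<Rightarrow> real)"
  by unfold_locales
    (auto simp: conj_real_def inner_commute power2_norm_eq_inner algebra_simps inner_add_left)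

lemma hilbert_space_complex: "hilbert_space (*) (\<lambda>x y :: complex. x * cnj y)"
  by unfold_locales
    (simp_all add: conj_complex_def scaleR_conv_of_real algebra_simps complex_norm_square
      del: of_real_power)

text \<open>
  Different Hilbert spaces are represented by closed subspaces of one ambient Hilbert space, so
  that a sequence of them can be indexed by the integers. This is no restriction for finitely
  many nonzero spaces: they are pairwise orthogonal closed subspaces of their direct sum.
  An operator from \<open>X\<close> to \<open>Y\<close> is a function on \<open>'a\<close> of which only the values on \<open>X\<close> matter.
\<close>

definition closed_subspace :: "('k::conj_field \<Rightarrow> 'a::banach \<Rightarrow> 'a) \<Rightarrow> 'a set \<Rightarrow> bool"
  where "closed_subspace smul X \<longleftrightarrow> module.subspace smul X \<and> closed X"

definition bounded_operator ::
    "('k::conj_field \<Rightarrow> 'a::banach \<Rightarrow> 'a) \<Rightarrow> 'a set \<Rightarrow> 'a set \<Rightarrow> ('a \<Rightarrow> 'a) \<Rightarrow> bool"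
  where "bounded_operator smul X Y T \<longleftrightarrow>
    T ` X \<subseteq> Y \<and>
    (\<forall>x\<in>X. \<forall>y\<in>X. T (x + y) = T x + T y) \<and>
    (\<forall>c. \<forall>x\<in>X. T (smul c x) = smul c (T x)) \<and>
    (\<exists>K. \<forall>x\<in>X. norm (T x) \<le> K * norm x)"

definition null_space :: "'a set \<Rightarrow> ('a \<Rightarrow> 'a::zero) \<Rightarrow> 'a set"
  where "null_space X T = {x \<in> X. T x = 0}"

text \<open>The description is proper, by the Riesz theorem, for bounded operators between closed subspaces.\<close>

definition hilbert_adjoint ::
    "('a \<Rightarrow> 'a \<Rightarrow> 'k) \<Rightarrow> 'a set \<Rightarrow> 'a set \<Rightarrow> ('a \<Rightarrow> 'a) \<Rightarrow> 'a \<Rightarrow> 'a"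
  where "hilbert_adjoint ip X Y T y = (THE z. z \<in> X \<and> (\<forall>x\<in>X. ip (T x) y = ip x z))"

definition self_adjoint_operator ::
    "('a \<Rightarrow> 'a \<Rightarrow> 'k) \<Rightarrow> 'a set \<Rightarrow> ('a \<Rightarrow> 'a) \<Rightarrow> bool"
  where "self_adjoint_operator ip X T \<longleftrightarrow> (\<forall>x\<in>X. hilbert_adjoint ip X X T x = T x)"

definition finite_dim :: "('k::field \<Rightarrow> 'a::ab_group_add \<Rightarrow> 'a) \<Rightarrow> 'a set \<Rightarrow> bool"
  where "finite_dim smul S \<longleftrightarrow> (\<exists>F. finite F \<and> F \<subseteq> S \<and> S \<subseteq> module.span smul F)"

text \<open>
  Finite dimension of the quotient \<open>N / M\<close>, for subspaces \<open>M \<subseteq> N\<close>: the classes of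
  finitely many elements of \<open>N\<close> span it, that is, \<open>x + M = y + M\<close> for some \<open>y\<close> in their span.
\<close>

definition finite_dim_quotient ::
    "('k::field \<Rightarrow> 'a::ab_group_add \<Rightarrow> 'a) \<Rightarrow> 'a set \<Rightarrow> 'a set \<Rightarrow> bool"
  where "finite_dim_quotient smul N M \<longleftrightarrow>
    (\<exists>F. finite F \<and> F \<subseteq> N \<and> (\<forall>x\<in>N. \<exists>y\<in>module.span smul F. x - y \<in> M))"

text \<open>The range of a Fredholm operator is automatically closed.\<close>

definition fredholm_operator ::
    "('k::conj_field \<Rightarrow> 'a::banach \<Rightarrow> 'a) \<Rightarrow> 'a set \<Rightarrow> 'a set \<Rightarrow> ('a \<Rightarrow> 'a) \<Rightarrow> bool"
  where "fredholm_operator smul X Y T \<longleftrightarrow>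
    bounded_operator smul X Y T \<and>
    finite_dim smul (null_space X T) \<and>
    finite_dim_quotient smul Y (T ` X)"

definition spaces_and_maps ::
    "('k::conj_field \<Rightarrow> 'a::banach \<Rightarrow> 'a) \<Rightarrow> nat \<Rightarrow> (int \<Rightarrow> 'a set) \<Rightarrow> (int \<Rightarrow> 'a \<Rightarrow> 'a) \<Rightarrow> bool"
  where "spaces_and_maps smul n H \<delta> \<longleftrightarrow>
    (\<forall>p. closed_subspace smul (H p)) \<and>
    (\<forall>p. bounded_operator smul (H p) (H (p - 1)) (\<delta> p)) \<and>
    (\<forall>p. p < 0 \<or> p \<ge> int n + 1 \<longrightarrow> H p = {0} \<and> (\<forall>x\<in>H p. \<delta> p x = 0))"

definition fredholm_chain ::
    "('k::conj_field \<Rightarrow> 'a::banach \<Rightarrow> 'a) \<Rightarrow> nat \<Rightarrow> (int \<Rightarrow> 'a set) \<Rightarrow> (int \<Rightarrow> 'a \<Rightarrow> 'a) \<Rightarrow> bool"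
  where "fredholm_chain smul n H \<delta> \<longleftrightarrow>
    spaces_and_maps smul n H \<delta> \<and>
    (\<forall>p\<in>{0..int n}.
      let N = null_space (H p) (\<delta> p); R = \<delta> (p + 1) ` H (p + 1)
      in finite_dim_quotient smul N (N \<inter> R) \<and> finite_dim_quotient smul R (N \<inter> R))"

end

theory Submission
  imports Defs
begin

text \<open>
  Fix one spot \<open>X \<rightarrow> Y \<rightarrow> Z\<close> of the sequence, with maps \<open>a\<close> and \<open>b\<close>, and let
  \<open>A = a a\<^sup>* + b\<^sup>* b\<close>. Write \<open>V \<preceq> W\<close> if \<open>V\<close> is contained in \<open>W\<close> up to finitely many
  dimensions. Everything is expressed in this preorder: the chain is Fredholm if the null
  space of \<open>b\<close> and the range of \<open>a\<close> almost contain each other at every spot, and the inclusion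
  \<open>R(a) \<preceq> N(b)\<close> is just the hypothesis that \<open>b a\<close> has finite rank.

  The analytic core (\<open>fredholm_laplacian_iff\<close>) is that \<open>A\<close> is Fredholm if and only if
  \<open>Y \<preceq> R(a) + R(b\<^sup>*)\<close>. Only sufficiency needs an argument. If a finite set \<open>F\<close> supplies the
  missing dimensions, then every vector of \<open>Y\<close> is \<open>a u + b\<^sup>* v + f\<close>, so the vectors \<open>y\<close> with
  \<open>|a\<^sup>* y|\<^sup>2 + |b y|\<^sup>2 + (\<Sum>f\<in>F. |(y, f)|\<^sup>2) \<le> 1\<close> form a weakly bounded set. By uniform boundedness
  it is bounded; hence the finite rank perturbation \<open>A + (\<Sum>f\<in>F. (-, f) f)\<close> is coercive, and
  therefore bijective on \<open>Y\<close>.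

  Given the core, (ii) implies (i) by projecting \<open>Y \<preceq> R(a) + R(b\<^sup>*)\<close> orthogonally to \<open>N(b)\<close>, which
  is orthogonal to \<open>R(b\<^sup>*)\<close> and almost contains \<open>R(a)\<close> (\<open>null_space_almost_subset_range\<close>).
  For the converse, \<open>Y \<preceq> R(a) + R(b\<^sup>*)\<close> is proved by induction along the sequence, starting
  where the spaces vanish. In the step \<open>R(b) \<preceq> R(b b\<^sup>*)\<close> is read off from the Laplacian on \<open>Z\<close>,
  whose other summand is orthogonal to the null space of the next map; pulling this back along
  \<open>b\<close> yields \<open>Y \<preceq> R(b\<^sup>*) + N(b)\<close>, and \<open>N(b) \<preceq> R(a)\<close> by (i) (\<open>almost_spanned_by_ranges\<close>).
\<close>

section \<open>Inclusion up to finite dimension\<close>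

context vector_space
begin

text \<open>
  The sets need not be subspaces: a union on the right stands for the sum of the spans, which
  keeps sums of subspaces out of the statements.
\<close>

definition almost_subset :: "'b set \<Rightarrow> 'b set \<Rightarrow> bool"  (infix "\<preceq>" 50)
  where "V \<preceq> W \<longleftrightarrow> (\<exists>F. finite F \<and> V \<subseteq> span (W \<union> F))"

lemma almost_subset_if_subset_span: "V \<preceq> W" if "V \<subseteq> span W"
  unfolding almost_subset_def using that by (intro exI[of _ "{}"]) auto

lemma almost_subset_if_subset_zero: "V \<preceq> W" if "V \<subseteq> {0}"
  using that span_zero[of W] by (intro almost_subset_if_subset_span) auto

lemma almost_subset_trans:
  assumes "V \<preceq> W" "W \<preceq> U"
  shows "V \<preceq> U"
proof -
  obtain F G where F: "finite F" "V \<subseteq> span (W \<union> F)" and G: "finite G" "W \<subseteq> span (U \<union> G)"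
    using assms unfolding almost_subset_def by blast
  have "W \<union> F \<subseteq> span (U \<union> (G \<union> F))"
    using G(2) span_mono[of "U \<union> G" "U \<union> (G \<union> F)"] span_superset[of "U \<union> (G \<union> F)"] by blast
  then have "span (W \<union> F) \<subseteq> span (U \<union> (G \<union> F))"
    by (rule span_minimal) simp
  with F G show ?thesis
    unfolding almost_subset_def by (intro exI[of _ "G \<union> F"]) blast
qed

lemma almost_subset_Un:
  assumes "V \<preceq> W" "V' \<preceq> W"
  shows "V \<union> V' \<preceq> W"
proof -
  obtain F G where F: "finite F" "V \<subseteq> span (W \<union> F)" and G: "finite G" "V' \<subseteq> span (W \<union> G)"
    using assms unfolding almost_subset_def by blast
  have "span (W \<union> F) \<subseteq> span (W \<union> (F \<union> G))" "span (W \<union> G) \<subseteq> span (W \<union> (F \<union> G))"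
    by (intro span_mono; blast)+
  with F G show ?thesis
    unfolding almost_subset_def by (intro exI[of _ "F \<union> G"]) blast
qed

lemma almost_subset_mono:
  assumes "V \<preceq> W" "V' \<subseteq> V" "W \<subseteq> W'"
  shows "V' \<preceq> W'"
proof -
  obtain F where F: "finite F" "V \<subseteq> span (W \<union> F)"
    using assms(1) unfolding almost_subset_def by blast
  moreover have "span (W \<union> F) \<subseteq> span (W' \<union> F)"
    using assms(3) by (intro span_mono) blast
  ultimately show ?thesis
    using assms(2) unfolding almost_subset_def by blast
qed

lemma almost_subset_image:
  assumes "module_hom scale scale f" "V \<preceq> W"
  shows "f ` V \<preceq> f ` W"
proof -
  obtain F where F: "finite F" "V \<subseteq> span (W \<union> F)"
    using assms unfolding almost_subset_def by blast
  then have "f ` V \<subseteq> span (f ` W \<union> f ` F)"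
    using module_hom.span_image[OF assms(1), of "W \<union> F"] by (auto simp: image_Un)
  with F(1) show ?thesis
    unfolding almost_subset_def by blast
qed

text \<open>
  Steinitz exchange: an extra generator that is needed for some \<open>v \<in> V\<close> lies in the span of \<open>v\<close>
  and the other generators, so it can be replaced by \<open>v\<close>.
\<close>

lemma almost_subset_obtain_generators:
  assumes "V \<preceq> W"
  obtains G where "finite G" "G \<subseteq> V" "V \<subseteq> span (W \<union> G)"
proof -
  have *: "\<exists>G. finite G \<and> G \<subseteq> V \<and> V \<subseteq> span (W \<union> G)"
    if "finite F" "V \<subseteq> span (W \<union> F)" for F
    using that
  proof (induction F arbitrary: W)
    case empty
    then show ?case by blast
  next
    case (insert f F)
    show ?case
    proof (cases "V \<subseteq> span (W \<union> F)")
      case True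
      then show ?thesis by (rule insert.IH)
    next
      case False
      then obtain v where v: "v \<in> V" "v \<notin> span (W \<union> F)" by blast
      have "v \<in> span (insert f (W \<union> F))"
        using insert.prems v(1) by auto
      then have "f \<in> span (insert v (W \<union> F))"
        using v(2) by (rule in_span_insert)
      then have "W \<union> insert f F \<subseteq> span (insert v W \<union> F)"
        using span_superset[of "insert v W \<union> F"] by auto
      then have "span (W \<union> insert f F) \<subseteq> span (insert v W \<union> F)"
        by (rule span_minimal) simp
      then obtain G where "finite G" "G \<subseteq> V" "V \<subseteq> span (insert v W \<union> G)"
        using insert.IH[of "insert v W"] insert.prems by blast
      with v(1) show ?thesis
        by (intro exI[of _ "insert v G"]) auto
    qed
  qed
  obtain F where "finite F" "V \<subseteq> span (W \<union> F)"
    using assms unfolding almost_subset_def by blast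
  from *[OF this] that show ?thesis by blast
qed

text \<open>
  An almost inclusion of images pulls back at the cost of the kernel. With \<open>W = {0}\<close> this is the
  fact that the kernel of a map of finite rank has finite codimension.
\<close>

lemma almost_subset_vimage:
  assumes f: "module_hom scale scale f" and V: "subspace V" and "W \<subseteq> V"
    and "f ` V \<preceq> f ` W"
  shows "V \<preceq> W \<union> {x \<in> V. f x = 0}"
proof -
  obtain G where G: "finite G" "G \<subseteq> f ` V" "f ` V \<subseteq> span (f ` W \<union> G)"
    using assms(4) by (rule almost_subset_obtain_generators)
  obtain G' where G': "G' \<subseteq> V" "finite G'" "G = f ` G'"
    using finite_subset_image[OF G(1,2)] by blast
  have "x \<in> span ((W \<union> {x \<in> V. f x = 0}) \<union> G')" if "x \<in> V" for x
  proof -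
    have "f x \<in> f ` span (W \<union> G')"
      using that G(3) G'(3) module_hom.span_image[OF f, of "W \<union> G'"] by (auto simp: image_Un)
    then obtain y where y: "y \<in> span (W \<union> G')" "f x = f y" by blast
    have "y \<in> V"
      using y(1) span_minimal[OF _ V, of "W \<union> G'"] \<open>W \<subseteq> V\<close> G'(1) by blast
    then have "x - y \<in> {x \<in> V. f x = 0}"
      using that y(2) V by (simp add: module_hom.diff[OF f] subspace_diff)
    then have "x - y \<in> span ((W \<union> {x \<in> V. f x = 0}) \<union> G')"
      by (intro span_base) blast
    moreover have "y \<in> span ((W \<union> {x \<in> V. f x = 0}) \<union> G')"
      using y(1) span_mono[of "W \<union> G'" "(W \<union> {x \<in> V. f x = 0}) \<union> G'"] by blast
    ultimately have "(x - y) + y \<in> span ((W \<union> {x \<in> V. f x = 0}) \<union> G')"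
      by (rule span_add)
    then show ?thesis by simp
  qed
  with G'(2) show ?thesis
    unfolding almost_subset_def by blast
qed

lemma finite_dim_iff_almost_subset: "finite_dim scale V \<longleftrightarrow> V \<preceq> {0}"
proof
  assume "finite_dim scale V"
  then show "V \<preceq> {0}"
    unfolding finite_dim_def almost_subset_def by (auto simp: span_insert_0)
next
  assume "V \<preceq> {0}"
  then obtain G where "finite G" "G \<subseteq> V" "V \<subseteq> span ({0} \<union> G)"
    by (rule almost_subset_obtain_generators)
  then show "finite_dim scale V"
    unfolding finite_dim_def by (auto simp: span_insert_0)
qed

lemma finite_dim_quotient_iff_almost_subset:
  assumes V: "subspace V" and W: "subspace W"
  shows "finite_dim_quotient scale V (V \<inter> W) \<longleftrightarrow> V \<preceq> W"
proof
  assume "finite_dim_quotient scale V (V \<inter> W)"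
  then obtain F where F: "finite F" "F \<subseteq> V" "\<And>x. x \<in> V \<Longrightarrow> \<exists>y\<in>span F. x - y \<in> V \<inter> W"
    unfolding finite_dim_quotient_def by blast
  have "x \<in> span (W \<union> F)" if "x \<in> V" for x
  proof -
    obtain y where "y \<in> span F" "x - y \<in> span W"
      using F(3)[OF \<open>x \<in> V\<close>] span_base by blast
    then have "(x - y) + y \<in> span (W \<union> F)"
      unfolding span_Un by blast
    then show ?thesis by simp
  qed
  with F(1) show "V \<preceq> W"
    unfolding almost_subset_def by blast
next
  assume "V \<preceq> W"
  then obtain G where G: "finite G" "G \<subseteq> V" "V \<subseteq> span (W \<union> G)"
    by (rule almost_subset_obtain_generators)
  have "\<exists>y\<in>span G. x - y \<in> V \<inter> W" if "x \<in> V" for x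
  proof -
    have "x \<in> span (W \<union> G)"
      using G(3) \<open>x \<in> V\<close> by blast
    then obtain w y where wy: "w \<in> W" "y \<in> span G" "x = w + y"
      unfolding span_Un span_eq_iff[THEN iffD2, OF W] by blast
    moreover have "y \<in> V"
      using wy(2) span_minimal[OF G(2) V] by blast
    ultimately show ?thesis
      using that subspace_diff[OF V, of x y] by (intro bexI[of _ y]) auto
  qed
  with G show "finite_dim_quotient scale V (V \<inter> W)"
    unfolding finite_dim_quotient_def by blast
qed

end

section \<open>Geometry of Hilbert spaces over an abstract scalar field\<close>

text \<open>
  Beyond additivity, the properties of the conjugation follow from \<open>x * conj x = |x|\<^sup>2\<close> by
  cancelling a nonzero factor.
\<close>

lemma conj_zero [simp]: "conj 0 = (0::'k::conj_field)"
  using conj_add[of 0 0] by simp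

lemma conj_minus: "conj (- x) = - conj (x::'k::conj_field)"
  using conj_add[of x "- x"] by (simp add: add_eq_0_iff)

lemma norm_conj [simp]: "norm (conj x) = norm (x::'k::conj_field)"
proof (cases "x = 0")
  case False
  have "norm x * norm (conj x) = (norm x)\<^sup>2"
    using arg_cong[OF mult_conj[of x], of norm] by (simp add: norm_mult)
  with False show ?thesis by (simp add: power2_eq_square)
qed simp

lemma conj_of_real [simp]: "conj (of_real r) = (of_real r :: 'k::conj_field)"
proof (cases "r = 0")
  case False
  have "(of_real r :: 'k) * conj (of_real r) = of_real r * of_real r"
    using mult_conj[of "of_real r :: 'k"]
    by (simp add: scaleR_conv_of_real power2_eq_square flip: abs_mult)
  with False show ?thesis by simp
qed simp

lemma conj_mult: "conj (x * y) = conj x * conj (y::'k::conj_field)"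
proof (cases "x * y = 0")
  case False
  have "(x * y) * conj (x * y) = (x * conj x) * (y * conj y)"
    unfolding mult_conj by (simp add: norm_mult power_mult_distrib)
  also have "\<dots> = (x * y) * (conj x * conj y)" by simp
  finally show ?thesis using False by (simp only: mult_cancel_left) simp
qed auto

lemma conj_conj [simp]: "conj (conj x) = (x::'k::conj_field)"
proof (cases "x = 0")
  case False
  have "conj x * conj (conj x) = conj x * x"
    using mult_conj[of "conj x"] mult_conj[of x] by (simp add: mult.commute)
  moreover have "conj x \<noteq> 0" using False by (metis norm_conj norm_eq_zero)
  ultimately show ?thesis by simp
qed simp

context hilbert_space
begin

notation almost_subset (infix "\<preceq>" 50)

lemma ip_zero_left [simp]: "ip 0 x = 0"
  using ip_add_left[of 0 0 x] by simp

lemma ip_minus_left: "ip (- x) y = - ip x y"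
  using ip_add_left[of x "- x" y] by (simp add: add_eq_0_iff)

lemma ip_diff_left: "ip (x - y) z = ip x z - ip y z"
  using ip_add_left[of x "- y" z] by (simp add: ip_minus_left)

lemma ip_zero_right [simp]: "ip x 0 = 0"
  using ip_conj[of x 0] by simp

lemma ip_add_right: "ip x (y + z) = ip x y + ip x z"
  using ip_conj[of x "y + z"] ip_conj[of x y] ip_conj[of x z] by (simp add: ip_add_left conj_add)

lemma ip_minus_right: "ip x (- y) = - ip x y"
  using ip_conj[of x "- y"] ip_conj[of x y] by (simp add: ip_minus_left conj_minus)

lemma ip_diff_right: "ip x (y - z) = ip x y - ip x z"
  using ip_add_right[of x y "- z"] by (simp add: ip_minus_right)

lemma ip_smul_right: "ip x (smul c y) = conj c * ip x y"
  using ip_conj[of x "smul c y"] ip_conj[of x y] by (simp add: ip_smul_left conj_mult)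

lemma ip_eq_0_commute: "ip x y = 0 \<longleftrightarrow> ip y x = 0"
  using ip_conj[of x y] ip_conj[of y x] by (metis conj_zero)

lemma ip_self_eq_0_iff [simp]: "ip x x = 0 \<longleftrightarrow> x = 0"
  by (simp add: ip_self)

lemma norm_smul: "norm (smul c x) = norm c * norm x"
proof -
  have "(of_real ((norm (smul c x))\<^sup>2) :: 'k) = c * conj c * of_real ((norm x)\<^sup>2)"
    by (simp only: ip_self[symmetric] ip_smul_left ip_smul_right mult_ac)
  also have "\<dots> = of_real ((norm c * norm x)\<^sup>2)"
    by (simp add: mult_conj scaleR_conv_of_real power_mult_distrib)
  finally have "(norm (smul c x))\<^sup>2 = (norm c * norm x)\<^sup>2"
    by (simp only: of_real_eq_iff)
  then show ?thesis by (simp add: power2_eq_iff_nonneg)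
qed

lemma norm_add_squared:
  "(of_real ((norm (x + y))\<^sup>2) :: 'k) = of_real ((norm x)\<^sup>2) + ip x y + ip y x + of_real ((norm y)\<^sup>2)"
  by (simp only: ip_self[symmetric] ip_add_left ip_add_right) (simp add: algebra_simps)

lemma norm_diff_squared:
  "(of_real ((norm (x - y))\<^sup>2) :: 'k) = of_real ((norm x)\<^sup>2) - ip x y - ip y x + of_real ((norm y)\<^sup>2)"
  by (simp only: ip_self[symmetric] ip_diff_left ip_diff_right) (simp add: algebra_simps)

lemma pythagoras:
  assumes "ip x y = 0"
  shows "(norm (x + y))\<^sup>2 = (norm x)\<^sup>2 + (norm y)\<^sup>2"
proof -
  have "(of_real ((norm (x + y))\<^sup>2) :: 'k) = of_real ((norm x)\<^sup>2 + (norm y)\<^sup>2)"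
    using norm_add_squared[of x y] assms ip_eq_0_commute[of x y] by simp
  then show ?thesis by (simp only: of_real_eq_iff)
qed

lemma parallelogram_law:
  fixes x y :: 'a
  shows
  "(norm (x + y))\<^sup>2 + (norm (x - y))\<^sup>2 = 2 * (norm x)\<^sup>2 + 2 * (norm y)\<^sup>2"
proof -
  have "(of_real ((norm (x + y))\<^sup>2 + (norm (x - y))\<^sup>2) :: 'k)
      = of_real (2 * (norm x)\<^sup>2 + 2 * (norm y)\<^sup>2)"
    using norm_add_squared[of x y] norm_diff_squared[of x y] by simp
  then show ?thesis by (simp only: of_real_eq_iff)
qed

lemma orthogonal_residual:
  fixes x y :: 'a
  assumes "y \<noteq> 0"
  defines "c \<equiv> ip x y / of_real ((norm y)\<^sup>2)"
  shows "ip (x - smul c y) y = 0"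
    and "(norm (x - smul c y))\<^sup>2 = (norm x)\<^sup>2 - (norm (ip x y) / norm y)\<^sup>2"
proof -
  show 0: "ip (x - smul c y) y = 0"
    using assms by (simp add: ip_diff_left ip_smul_left ip_self)
  then have "ip (x - smul c y) (smul c y) = 0"
    by (simp add: ip_smul_right)
  from pythagoras[OF this]
  have "(norm x)\<^sup>2 = (norm (x - smul c y))\<^sup>2 + (norm c * norm y)\<^sup>2"
    by (simp add: norm_smul)
  moreover have "norm c * norm y = norm (ip x y) / norm y"
    using assms(1) by (simp add: c_def norm_divide norm_mult power2_eq_square)
  ultimately show "(norm (x - smul c y))\<^sup>2 = (norm x)\<^sup>2 - (norm (ip x y) / norm y)\<^sup>2"
    by simp
qed

lemma Cauchy_Schwarz: "norm (ip x y) \<le> norm x * norm y"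
proof (cases "y = 0")
  case False
  have "(norm (ip x y) / norm y)\<^sup>2 \<le> (norm x)\<^sup>2"
    using orthogonal_residual(2)[OF False, of x] zero_le_power2[of "norm (x - smul (ip x y / of_real ((norm y)\<^sup>2)) y)"]
    by linarith
  then have "norm (ip x y) / norm y \<le> norm x"
    by (rule power2_le_imp_le) simp
  with False show ?thesis by (simp add: divide_le_eq)
qed simp


definition proj :: "'a set \<Rightarrow> 'a \<Rightarrow> 'a"
  where "proj X y = (SOME p. p \<in> X \<and> (\<forall>x\<in>X. ip (y - p) x = 0))"

text \<open>
  A minimising sequence for the distance to \<open>X\<close> is Cauchy by the parallelogram law. At its limit \<open>p\<close>
  the residual is orthogonal to \<open>X\<close>, since otherwise moving \<open>p\<close> along a vector of \<open>X\<close> would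
  decrease the distance.
\<close>

lemma projection_exists:
  assumes "closed_subspace smul X"
  shows "\<exists>p\<in>X. \<forall>x\<in>X. ip (y - p) x = 0"
proof -
  have X: "subspace X" "closed X"
    using assms unfolding closed_subspace_def by auto
  define D where "D = (INF x\<in>X. (norm (y - x))\<^sup>2)"
  have bdd: "bdd_below ((\<lambda>x. (norm (y - x))\<^sup>2) ` X)"
    by (intro bdd_belowI2[of _ 0]) simp
  have D_le: "D \<le> (norm (y - x))\<^sup>2" if "x \<in> X" for x
    unfolding D_def using bdd that by (rule cINF_lower)
  have "\<exists>x\<in>X. (norm (y - x))\<^sup>2 < D + inverse (real (Suc k))" for k
  proof -
    have "X \<noteq> {}" using subspace_0[OF X(1)] by blast
    then show ?thesis
      using cINF_less_iff[OF _ bdd, of "D + inverse (real (Suc k))"] unfolding D_def by simp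
  qed
  then obtain s where s: "\<And>k. s k \<in> X" "\<And>k. (norm (y - s k))\<^sup>2 < D + inverse (real (Suc k))"
    by metis
  \<comment> \<open>The midpoint of two near-minimisers also lies in X, so its distance is at least D.\<close>
  have near: "(norm (x - x'))\<^sup>2 \<le> 2 * ((norm (y - x))\<^sup>2 - D) + 2 * ((norm (y - x'))\<^sup>2 - D)"
    if "x \<in> X" "x' \<in> X" for x x'
  proof -
    have "(1/2) *\<^sub>R (x + x') \<in> X"
      using that X(1) by (simp add: subspace_add subspace_scale flip: smul_of_real)
    then have "D \<le> (norm (y - (1/2) *\<^sub>R (x + x')))\<^sup>2"
      by (rule D_le)
    moreover have "(y - x) + (y - x') = 2 *\<^sub>R (y - (1/2) *\<^sub>R (x + x'))"
      by (simp add: algebra_simps scaleR_2)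
    then have "(norm ((y - x) + (y - x')))\<^sup>2 = 4 * (norm (y - (1/2) *\<^sub>R (x + x')))\<^sup>2"
      by (simp add: power_mult_distrib)
    moreover have "norm ((y - x) - (y - x')) = norm (x - x')"
      by (simp add: norm_minus_commute)
    ultimately show ?thesis
      using parallelogram_law[of "y - x" "y - x'"] by simp
  qed
  have "Cauchy s"
  proof (rule CauchyI)
    fix e :: real
    assume "0 < e"
    then obtain N where N: "inverse (real (Suc N)) < e\<^sup>2 / 4"
      using reals_Archimedean[of "e\<^sup>2 / 4"] by auto
    have "norm (s m - s k) < e" if "N \<le> m" "N \<le> k" for m k
    proof -
      have "inverse (real (Suc j)) \<le> inverse (real (Suc N))" if "N \<le> j" for j
        using that by (intro le_imp_inverse_le) auto
      from this[OF that(1)] this[OF that(2)] have "(norm (s m - s k))\<^sup>2 < e\<^sup>2"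
        using near[OF s(1)[of m] s(1)[of k]] s(2)[of m] s(2)[of k] N by argo
      then show ?thesis
        using \<open>0 < e\<close> by (intro power2_less_imp_less[of "norm (s m - s k)" e]) auto
    qed
    then show "\<exists>M. \<forall>m\<ge>M. \<forall>n\<ge>M. norm (s m - s n) < e" by blast
  qed
  then obtain p where lim: "s \<longlonglongrightarrow> p"
    using Cauchy_convergent convergent_def by blast
  have "p \<in> X"
    using X(2) s(1) lim closed_sequentially by blast
  have "(norm (y - p))\<^sup>2 \<le> D"
  proof (rule LIMSEQ_le)
    show "(\<lambda>k. (norm (y - s k))\<^sup>2) \<longlonglongrightarrow> (norm (y - p))\<^sup>2"
      by (intro tendsto_intros lim)
    show "(\<lambda>k. D + inverse (real (Suc k))) \<longlonglongrightarrow> D"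
      using tendsto_add[OF tendsto_const LIMSEQ_inverse_real_of_nat, of D] by simp
    show "\<exists>N. \<forall>k\<ge>N. (norm (y - s k))\<^sup>2 \<le> D + inverse (real (Suc k))"
      using s(2) less_imp_le by blast
  qed
  have "ip (y - p) x = 0" if "x \<in> X" for x
  proof (cases "x = 0")
    case False
    define c where "c = ip (y - p) x / of_real ((norm x)\<^sup>2)"
    have "p + smul c x \<in> X"
      using \<open>p \<in> X\<close> that X(1) by (simp add: subspace_add subspace_scale)
    then have "D \<le> (norm (y - p - smul c x))\<^sup>2"
      using D_le by (metis diff_diff_add)
    then have "(norm (ip (y - p) x) / norm x)\<^sup>2 \<le> 0"
      using orthogonal_residual(2)[OF False, of "y - p"] \<open>(norm (y - p))\<^sup>2 \<le> D\<close>
      unfolding c_def by linarith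
    with False show ?thesis by simp
  qed simp
  with \<open>p \<in> X\<close> show ?thesis by blast
qed

lemma
  assumes "closed_subspace smul X"
  shows proj_in: "proj X y \<in> X"
    and ip_proj_residual: "x \<in> X \<Longrightarrow> ip (y - proj X y) x = 0"
proof -
  have "\<exists>p. p \<in> X \<and> (\<forall>x\<in>X. ip (y - p) x = 0)"
    using projection_exists[OF assms, of y] by blast
  from someI_ex[OF this] show "proj X y \<in> X" "x \<in> X \<Longrightarrow> ip (y - proj X y) x = 0" 
    unfolding proj_def by auto
qed

lemma proj_eqI:
  assumes X: "closed_subspace smul X" and p: "p \<in> X" "\<And>x. x \<in> X \<Longrightarrow> ip (y - p) x = 0"
  shows "proj X y = p"
proof -
  have "subspace X" using X unfolding closed_subspace_def by blast
  then have d: "proj X y - p \<in> X"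
    using proj_in[OF X] p(1) by (simp add: subspace_diff)
  have "ip (proj X y - p) (proj X y - p) = ip (y - p) (proj X y - p) - ip (y - proj X y) (proj X y - p)"
    by (simp flip: ip_diff_left)
  also have "\<dots> = 0"
    using p(2)[OF d] ip_proj_residual[OF X d] by simp
  finally show ?thesis by simp
qed

lemma proj_id:
  assumes "closed_subspace smul X" "y \<in> X"
  shows "proj X y = y"
  using assms by (intro proj_eqI) auto

lemma proj_eq_0:
  assumes "closed_subspace smul X" "\<And>x. x \<in> X \<Longrightarrow> ip y x = 0"
  shows "proj X y = 0"
  using assms by (intro proj_eqI) (auto simp: closed_subspace_def subspace_0)

lemma module_hom_smulI:
  assumes "\<And>x y. f (x + y) = f x + f y" "\<And>c x. f (smul c x) = smul c (f x)"
  shows "module_hom smul smul f"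
  by (intro module_hom.intro module_hom_axioms.intro module_axioms) (use assms in auto)

lemma module_hom_proj:
  assumes X: "closed_subspace smul X"
  shows "module_hom smul smul (proj X)"
proof (rule module_hom_smulI)
  have S: "subspace X" using X unfolding closed_subspace_def by blast
  show "proj X (x + y) = proj X x + proj X y" for x y
  proof (rule proj_eqI[OF X])
    show "proj X x + proj X y \<in> X"
      using proj_in[OF X] S by (simp add: subspace_add)
    show "ip (x + y - (proj X x + proj X y)) z = 0" if "z \<in> X" for z
      using ip_proj_residual[OF X that, of x] ip_proj_residual[OF X that, of y]
      by (simp add: ip_diff_left ip_add_left)
  qed
  show "proj X (smul c x) = smul c (proj X x)" for c x
  proof (rule proj_eqI[OF X])
    show "smul c (proj X x) \<in> X"
      using proj_in[OF X] S by (simp add: subspace_scale)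
    show "ip (smul c x - smul c (proj X x)) z = 0" if "z \<in> X" for z
      using ip_proj_residual[OF X that, of x]
      by (simp add: ip_smul_left flip: scale_right_diff_distrib)
  qed
qed

text \<open>
  The representing vector is a multiple of any \<open>w \<noteq> 0\<close> in the orthogonal complement of the kernel
  of \<open>f\<close> in \<open>X\<close>, because that complement is a line unless \<open>f = 0\<close>.
\<close>

lemma riesz_representation:
  assumes X: "closed_subspace smul X"
    and add: "\<And>x y. x \<in> X \<Longrightarrow> y \<in> X \<Longrightarrow> f (x + y) = f x + f y"
    and scale: "\<And>c x. x \<in> X \<Longrightarrow> f (smul c x) = c * f x"
    and bound: "\<And>x. x \<in> X \<Longrightarrow> norm (f x) \<le> K * norm x"
  shows "\<exists>z\<in>X. \<forall>x\<in>X. f x = ip x z"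
proof (cases "\<forall>x\<in>X. f x = 0")
  case True
  then show ?thesis
    using X by (intro bexI[of _ 0]) (auto simp: closed_subspace_def subspace_0)
next
  case False
  then obtain u where u: "u \<in> X" "f u \<noteq> 0" by blast
  have S: "subspace X" "closed X" using X unfolding closed_subspace_def by auto
  have diff: "f (x - y) = f x - f y" if "x \<in> X" "y \<in> X" for x y
    using add[of "x - y" y] that S(1) by (simp add: subspace_diff)
  define N where "N = {x \<in> X. f x = 0}"
  have "closed_subspace smul N"
    unfolding closed_subspace_def
  proof
    have "f 0 = 0" using scale[of 0 0] subspace_0[OF S(1)] by simp
    then show "subspace N"
      unfolding N_def subspace_def using S(1) add scale
      by (auto simp: subspace_0 subspace_add subspace_scale)
    show "closed N"
      unfolding closed_sequential_limits
    proof (intro allI impI)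
      fix s l
      assume "(\<forall>k. s k \<in> N) \<and> s \<longlonglongrightarrow> l"
      then have s: "\<And>k. s k \<in> X" "\<And>k. f (s k) = 0" "s \<longlonglongrightarrow> l"
        unfolding N_def by auto
      then have l: "l \<in> X" using S(2) closed_sequentially by blast
      have "norm (f l) \<le> K * norm (l - s k)" for k
        using bound[of "l - s k"] l s diff[of l "s k"] S(1) by (simp add: subspace_diff)
      moreover have "(\<lambda>k. K * norm (l - s k)) \<longlonglongrightarrow> K * norm (l - l)"
        by (intro tendsto_intros s)
      ultimately have "norm (f l) \<le> K * norm (l - l)"
        by (intro LIMSEQ_le_const) auto
      with l show "l \<in> N" unfolding N_def by simp
    qed
  qed
  define w where "w = u - proj N u"
  have pN: "proj N u \<in> N" by (rule proj_in) fact
  have w: "w \<in> X" "f w \<noteq> 0"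
    using u pN S(1) unfolding w_def N_def by (auto simp: diff subspace_diff)
  have w_orth: "ip x w = 0" if "x \<in> N" for x
    using ip_proj_residual[OF \<open>closed_subspace smul N\<close> that, of u] ip_eq_0_commute unfolding w_def by blast
  have "w \<noteq> 0" using w(2) pN u unfolding w_def by (auto simp: diff[of u u, simplified])
  define z where "z = smul (conj (f w) / of_real ((norm w)\<^sup>2)) w"
  have "f x = ip x z" if "x \<in> X" for x
  proof -
    define c where "c = f x / f w"
    have "smul c w \<in> X" using w(1) S(1) by (simp add: subspace_scale)
    then have "x - smul c w \<in> N"
      using that w S(1) unfolding N_def by (simp add: diff subspace_diff scale c_def)
    then have "ip x w = c * of_real ((norm w)\<^sup>2)"
      using w_orth[of "x - smul c w"] by (simp add: ip_diff_left ip_smul_left ip_self)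
    moreover have "conj (conj (f w) / of_real ((norm w)\<^sup>2)) = f w / of_real ((norm w)\<^sup>2)"
      using conj_mult[of "conj (f w)" "of_real (inverse ((norm w)\<^sup>2))"]
      by (simp only: divide_inverse conj_of_real conj_conj flip: of_real_inverse)
    ultimately show ?thesis
      using \<open>w \<noteq> 0\<close> w(2) unfolding z_def ip_smul_right c_def by simp
  qed
  moreover have "z \<in> X" unfolding z_def using w(1) S(1) by (simp add: subspace_scale)
  ultimately show ?thesis by blast
qed

text \<open>
  The sets of vectors on which all functionals \<open>ip y\<close>, \<open>y \<in> S\<close>, are bounded by \<open>k\<close> are closed and
  cover the space. By Baire one of them contains a ball, and the functionals are bounded
  uniformly on the ball.
\<close>

lemma uniform_boundedness:
  assumes "\<And>z. \<exists>B. \<forall>y\<in>S. norm (ip y z) \<le> B"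
  obtains B where "\<And>y. y \<in> S \<Longrightarrow> norm y \<le> B"
proof -
  define C where "C k = {z. \<forall>y\<in>S. norm (ip y z) \<le> real k}" for k
  have closed: "closed (C k)" for k
  proof -
    have "continuous_on UNIV (\<lambda>z. ip y z)" for y
    proof (rule lipschitz_on_continuous_on[of "norm y"], rule lipschitz_onI)
      show "dist (ip y z) (ip y z') \<le> norm y * dist z z'" for z z'
        using Cauchy_Schwarz[of y "z - z'"] by (simp add: dist_norm ip_diff_right)
    qed simp
    then have "closed {z. norm (ip y z) \<le> real k}" for y
      by (intro closed_Collect_le continuous_intros)
    moreover have "C k = (\<Inter>y\<in>S. {z. norm (ip y z) \<le> real k})"
      unfolding C_def by blast
    ultimately show ?thesis by auto
  qed
  have "z \<in> (\<Union>k. C k)" for z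
  proof -
    obtain B where "\<forall>y\<in>S. norm (ip y z) \<le> B" using assms by blast
    moreover obtain k where "B \<le> real k" using real_arch_simple by blast
    ultimately have "\<forall>y\<in>S. norm (ip y z) \<le> real k"
      using order_trans by blast
    then show ?thesis unfolding C_def by blast
  qed
  then have "(\<Union>k. C k) = UNIV" by blast
  moreover have "interior (\<Union>k. C k) = {}" if "\<And>k. interior (C k) = {}"
    using Baire_category_alt[of "euclidean :: 'a topology" "range C"] that closed
    by (auto simp: completely_metrizable_space_euclidean)
  ultimately obtain k where "interior (C k) \<noteq> {}" by force
  then obtain z where "z \<in> interior (C k)" by blast
  then obtain r where "0 < r" "cball z r \<subseteq> C k"
    unfolding mem_interior_cball by blast
  then have C: "norm (ip y z') \<le> real k" if "y \<in> S" "norm (z' - z) \<le> r" for y z'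
    using that unfolding C_def by (auto simp: subset_iff dist_norm norm_minus_commute)
  have "norm y \<le> 2 * real k / r" if "y \<in> S" for y
  proof (cases "y = 0")
    case True
    with \<open>0 < r\<close> show ?thesis by simp
  next
    case False
    define d where "d = smul (of_real (r / norm y)) y"
    have "norm d = r" using False \<open>0 < r\<close> by (simp add: d_def norm_smul norm_divide)
    have "ip y d = of_real (r / norm y * (norm y)\<^sup>2)"
      unfolding d_def ip_smul_right conj_of_real ip_self by simp
    also have "r / norm y * (norm y)\<^sup>2 = r * norm y"
      using False by (simp add: power2_eq_square)
    finally have "r * norm y = norm (ip y d)"
      using \<open>0 < r\<close> by (simp only: norm_of_real) simp
    also have "\<dots> = norm (ip y (z + d) - ip y z)"
      by (simp add: ip_add_right)
    also have "\<dots> \<le> norm (ip y (z + d)) + norm (ip y z)"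
      by (rule norm_triangle_ineq4)
    also have "\<dots> \<le> real k + real k"
      using \<open>norm d = r\<close> \<open>0 < r\<close> that by (intro add_mono C) auto
    finally show ?thesis using \<open>0 < r\<close> by (simp add: field_simps)
  qed
  then show ?thesis by (rule that)
qed


section \<open>Bounded operators and adjoints\<close>

lemma bounded_operator_in: "bounded_operator smul X Y T \<Longrightarrow> x \<in> X \<Longrightarrow> T x \<in> Y"
  unfolding bounded_operator_def by blast

lemma bounded_operator_add:
  "bounded_operator smul X Y T \<Longrightarrow> x \<in> X \<Longrightarrow> y \<in> X \<Longrightarrow> T (x + y) = T x + T y"
  unfolding bounded_operator_def by blast

lemma bounded_operator_smul:
  "bounded_operator smul X Y T \<Longrightarrow> x \<in> X \<Longrightarrow> T (smul c x) = smul c (T x)"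
  unfolding bounded_operator_def by blast

lemma bounded_operator_bound:
  assumes "bounded_operator smul X Y T"
  obtains K where "0 < K" "\<And>x. x \<in> X \<Longrightarrow> norm (T x) \<le> K * norm x"
proof -
  obtain K where K: "\<And>x. x \<in> X \<Longrightarrow> norm (T x) \<le> K * norm x"
    using assms unfolding bounded_operator_def by blast
  have "norm (T x) \<le> max K 1 * norm x" if "x \<in> X" for x
    using K[OF that] mult_right_mono[of K "max K 1" "norm x"] by simp
  then show ?thesis by (intro that[of "max K 1"]) auto
qed

lemma bounded_operatorI:
  assumes "\<And>x. x \<in> X \<Longrightarrow> T x \<in> Y"
    and "\<And>x y. x \<in> X \<Longrightarrow> y \<in> X \<Longrightarrow> T (x + y) = T x + T y"
    and "\<And>c x. x \<in> X \<Longrightarrow> T (smul c x) = smul c (T x)"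
    and "\<And>x. x \<in> X \<Longrightarrow> norm (T x) \<le> K * norm x"
  shows "bounded_operator smul X Y T"
  unfolding bounded_operator_def using assms by blast

lemma bounded_operator_compose:
  assumes S: "bounded_operator smul Y Z S" and T: "bounded_operator smul X Y T"
  shows "bounded_operator smul X Z (\<lambda>x. S (T x))"
proof -
  obtain K where K: "0 < K" "\<And>y. y \<in> Y \<Longrightarrow> norm (S y) \<le> K * norm y"
    using S by (rule bounded_operator_bound) blast
  obtain L where L: "0 < L" "\<And>x. x \<in> X \<Longrightarrow> norm (T x) \<le> L * norm x"
    using T by (rule bounded_operator_bound) blast
  show ?thesis
  proof (rule bounded_operatorI[where K = "K * L"])
    fix x assume x: "x \<in> X"
    then have "norm (S (T x)) \<le> K * norm (T x)"
      by (intro K bounded_operator_in[OF T])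
    also have "\<dots> \<le> K * (L * norm x)"
      using K(1) x by (intro mult_left_mono L) auto
    finally show "norm (S (T x)) \<le> K * L * norm x" by simp
  qed (simp_all add: bounded_operator_in[OF T] bounded_operator_in[OF S]
      bounded_operator_add[OF T] bounded_operator_add[OF S]
      bounded_operator_smul[OF T] bounded_operator_smul[OF S])
qed

lemma bounded_operator_sum:
  assumes Y: "subspace Y"
    and S: "bounded_operator smul X Y S" and T: "bounded_operator smul X Y T"
  shows "bounded_operator smul X Y (\<lambda>x. S x + T x)"
proof -
  obtain K where K: "0 < K" "\<And>x. x \<in> X \<Longrightarrow> norm (S x) \<le> K * norm x"
    using S by (rule bounded_operator_bound) blast
  obtain L where L: "0 < L" "\<And>x. x \<in> X \<Longrightarrow> norm (T x) \<le> L * norm x"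
    using T by (rule bounded_operator_bound) blast
  show ?thesis
  proof (rule bounded_operatorI[where K = "K + L"])
    show "norm (S x + T x) \<le> (K + L) * norm x" if "x \<in> X" for x
      using norm_triangle_ineq[of "S x" "T x"] K(2)[OF that] L(2)[OF that]
      by (simp add: distrib_right)
    show "S x + T x \<in> Y" if "x \<in> X" for x
      using Y that by (simp add: subspace_add bounded_operator_in[OF S] bounded_operator_in[OF T])
  qed (simp_all add: bounded_operator_add[OF S] bounded_operator_add[OF T]
      bounded_operator_smul[OF S] bounded_operator_smul[OF T] scale_right_distrib algebra_simps)
qed

text \<open>
  An operator given on a closed subspace extends to a linear map of the ambient space, by
  composition with the orthogonal projection. This makes the calculus of almost inclusions
  available, which is formulated for linear maps defined everywhere.
\<close>

lemma module_hom_compose_proj: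
  assumes X: "closed_subspace smul X" and T: "bounded_operator smul X Y T"
  shows "module_hom smul smul (\<lambda>x. T (proj X x))"
  by (rule module_hom_smulI)
    (simp_all add: module_hom.add[OF module_hom_proj[OF X]] module_hom.scale[OF module_hom_proj[OF X]]
      bounded_operator_add[OF T] bounded_operator_smul[OF T] proj_in[OF X])

lemma image_compose_proj:
  assumes "closed_subspace smul X" "V \<subseteq> X"
  shows "(\<lambda>x. T (proj X x)) ` V = T ` V"
  using assms by (intro image_cong) (auto simp: proj_id subset_iff)

lemma subspace_bounded_operator_image:
  assumes X: "closed_subspace smul X" and T: "bounded_operator smul X Y T"
  shows "subspace (T ` X)"
  using module_hom.subspace_image[OF module_hom_compose_proj[OF X T], of X] X
  by (simp add: image_compose_proj closed_subspace_def)

lemma bounded_operator_diff: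
  assumes X: "closed_subspace smul X" and T: "bounded_operator smul X Y T"
    and "x \<in> X" "y \<in> X"
  shows "T (x - y) = T x - T y"
  using module_hom.diff[OF module_hom_compose_proj[OF X T], of x y] assms
  by (simp add: proj_id closed_subspace_def subspace_diff)

lemma bounded_operator_zero:
  assumes X: "closed_subspace smul X" and T: "bounded_operator smul X Y T"
  shows "T 0 = 0"
  using bounded_operator_diff[OF assms, of 0 0] X by (simp add: closed_subspace_def subspace_0)

lemma closed_subspace_null_space:
  assumes X: "closed_subspace smul X" and T: "bounded_operator smul X Y T"
  shows "closed_subspace smul (null_space X T)"
  unfolding closed_subspace_def
proof
  have S: "subspace X" "closed X" using X unfolding closed_subspace_def by auto
  show "subspace (null_space X T)"
    unfolding null_space_def subspace_def using S(1)
    by (auto simp: subspace_0 subspace_add subspace_scale bounded_operator_zero[OF X T]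
        bounded_operator_add[OF T] bounded_operator_smul[OF T])
  obtain K where K: "\<And>x. x \<in> X \<Longrightarrow> norm (T x) \<le> K * norm x"
    using T unfolding bounded_operator_def by blast
  have "continuous_on X T"
  proof (rule lipschitz_on_continuous_on[of "max K 0"], rule lipschitz_onI)
    fix x y assume "x \<in> X" "y \<in> X"
    then have "norm (T x - T y) \<le> K * norm (x - y)"
      using K[of "x - y"] S(1) by (simp add: bounded_operator_diff[OF X T] subspace_diff)
    also have "\<dots> \<le> max K 0 * norm (x - y)"
      by (intro mult_right_mono) auto
    finally show "dist (T x) (T y) \<le> max K 0 * dist x y"
      by (simp add: dist_norm)
  qed simp
  then have "closed (X \<inter> T -` {0})"
    using S(2) by (intro continuous_closed_preimage) auto
  then show "closed (null_space X T)"
    unfolding null_space_def by (simp add: vimage_def Int_def)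
qed

text \<open>
  The adjoint is meaningful at every vector of the ambient space, not only on \<open>Y\<close>, as
  \<open>ip (T x) y\<close> is a bounded functional of \<open>x \<in> X\<close> for every \<open>y\<close>.
\<close>

lemma
  assumes X: "closed_subspace smul X" and T: "bounded_operator smul X Y T"
  shows hilbert_adjoint_in: "hilbert_adjoint ip X Y T y \<in> X"
    and ip_hilbert_adjoint: "x \<in> X \<Longrightarrow> ip (T x) y = ip x (hilbert_adjoint ip X Y T y)"
    and hilbert_adjoint_eqI:
      "z \<in> X \<Longrightarrow> (\<And>x. x \<in> X \<Longrightarrow> ip (T x) y = ip x z) \<Longrightarrow> hilbert_adjoint ip X Y T y = z"
proof -
  have S: "subspace X" using X unfolding closed_subspace_def by blast
  obtain K where K: "0 < K" "\<And>x. x \<in> X \<Longrightarrow> norm (T x) \<le> K * norm x"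
    using T by (rule bounded_operator_bound) blast
  have "norm (ip (T x) y) \<le> (K * norm y) * norm x" if "x \<in> X" for x
    using Cauchy_Schwarz[of "T x" y] mult_right_mono[OF K(2)[OF that], of "norm y"]
    by (simp add: mult_ac)
  then have "\<exists>z\<in>X. \<forall>x\<in>X. ip (T x) y = ip x z"
    using X by (intro riesz_representation)
      (auto simp: bounded_operator_add[OF T] bounded_operator_smul[OF T] ip_add_left ip_smul_left)
  moreover have unique: "z = z'"
    if "z \<in> X" "\<forall>x\<in>X. ip (T x) y = ip x z" "z' \<in> X" "\<forall>x\<in>X. ip (T x) y = ip x z'" for z z'
  proof -
    have "z - z' \<in> X" using that S by (simp add: subspace_diff)
    then have "ip (z - z') (z - z') = 0"
      using that by (metis ip_diff_right right_minus_eq)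
    then show ?thesis by simp
  qed
  ultimately have "\<exists>!z. z \<in> X \<and> (\<forall>x\<in>X. ip (T x) y = ip x z)"
    by blast
  from theI'[OF this]
  have adj: "hilbert_adjoint ip X Y T y \<in> X \<and> (\<forall>x\<in>X. ip (T x) y = ip x (hilbert_adjoint ip X Y T y))"
    unfolding hilbert_adjoint_def .
  then show "hilbert_adjoint ip X Y T y \<in> X"
    and "x \<in> X \<Longrightarrow> ip (T x) y = ip x (hilbert_adjoint ip X Y T y)"
    by auto
  show "hilbert_adjoint ip X Y T y = z" if "z \<in> X" "\<And>x. x \<in> X \<Longrightarrow> ip (T x) y = ip x z"
    using adj that by (intro unique) auto
qed

lemma ip_hilbert_adjoint_left:
  assumes "closed_subspace smul X" "bounded_operator smul X Y T" "x \<in> X"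
  shows "ip (hilbert_adjoint ip X Y T y) x = ip y (T x)"
  using ip_hilbert_adjoint[OF assms, of y] ip_conj by metis

lemma bounded_operator_hilbert_adjoint:
  assumes X: "closed_subspace smul X" and T: "bounded_operator smul X Y T"
  shows "bounded_operator smul Y' X (hilbert_adjoint ip X Y T)"
proof -
  have S: "subspace X" using X unfolding closed_subspace_def by blast
  note adj = hilbert_adjoint_in[OF X T] ip_hilbert_adjoint[OF X T]
  obtain K where K: "0 < K" "\<And>x. x \<in> X \<Longrightarrow> norm (T x) \<le> K * norm x"
    using T by (rule bounded_operator_bound) blast
  show ?thesis
  proof (rule bounded_operatorI[where K = K])
    fix x y
    show "hilbert_adjoint ip X Y T (x + y) = hilbert_adjoint ip X Y T x + hilbert_adjoint ip X Y T y"
      using S by (intro hilbert_adjoint_eqI[OF X T]) (simp_all add: adj subspace_add ip_add_right)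
  next
    fix c x
    show "hilbert_adjoint ip X Y T (smul c x) = smul c (hilbert_adjoint ip X Y T x)"
      using S by (intro hilbert_adjoint_eqI[OF X T]) (simp_all add: adj subspace_scale ip_smul_right)
  next
    fix y
    let ?z = "hilbert_adjoint ip X Y T y"
    have "(norm ?z)\<^sup>2 = norm (ip ?z ?z)"
      by (simp add: ip_self norm_power)
    also have "\<dots> = norm (ip (T ?z) y)"
      by (simp add: adj)
    also have "\<dots> \<le> norm (T ?z) * norm y"
      by (rule Cauchy_Schwarz)
    also have "\<dots> \<le> K * norm ?z * norm y"
      by (intro mult_right_mono K adj) auto
    finally have "norm ?z * norm ?z \<le> norm ?z * (K * norm y)"
      by (simp add: power2_eq_square mult_ac)
    then show "norm ?z \<le> K * norm y"
      using K(1) by (cases "?z = 0") (auto simp: mult_le_cancel_left)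
  qed (rule adj)
qed

text \<open>
  The Lax--Milgram theorem for a real-valued quadratic form. The equation \<open>D y = z\<close> is solved by
  the iteration \<open>y - \<rho> (D y - z)\<close>. With \<open>K\<close> a bound for the norm of \<open>D\<close>, expanding the square gives
  \<open>|u - \<rho> D u|\<^sup>2 \<le> (1 - 2 \<rho> \<gamma> + \<rho>\<^sup>2 K\<^sup>2) |u|\<^sup>2\<close>, and \<open>\<rho> = \<gamma> / K\<^sup>2\<close> minimises the factor.
\<close>

lemma coercive_bijective:
  assumes Y: "closed_subspace smul Y" and D: "bounded_operator smul Y Y D"
    and "0 < \<gamma>"
    and real: "\<And>y. y \<in> Y \<Longrightarrow> ip (D y) y = of_real (q y)"
    and coercive: "\<And>y. y \<in> Y \<Longrightarrow> \<gamma> * (norm y)\<^sup>2 \<le> q y"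
  shows "D ` Y = Y" and "\<And>y. y \<in> Y \<Longrightarrow> D y = 0 \<Longrightarrow> y = 0"
proof -
  have S: "subspace Y" "closed Y" using Y unfolding closed_subspace_def by auto
  show "y = 0" if "y \<in> Y" "D y = 0" for y
  proof -
    have "q y = 0" using real[OF that(1)] that(2) by simp
    with coercive[OF that(1)] \<open>0 < \<gamma>\<close> show ?thesis
      by (simp add: mult_le_0_iff)
  qed
  obtain K0 where K0: "0 < K0" "\<And>y. y \<in> Y \<Longrightarrow> norm (D y) \<le> K0 * norm y"
    using D by (rule bounded_operator_bound) blast
  \<comment> \<open>Enlarging the bound makes the radicand in the contraction constant nonnegative.\<close>
  define K where "K = max K0 \<gamma>"
  have K: "0 < K" "\<gamma> \<le> K" using K0(1) unfolding K_def by auto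
  have K_bound: "norm (D y) \<le> K * norm y" if "y \<in> Y" for y
    using K0(2)[OF that] mult_right_mono[of K0 K "norm y"] unfolding K_def by simp
  define \<rho> where "\<rho> = \<gamma> / K\<^sup>2"
  have "0 < \<rho>" using \<open>0 < \<gamma>\<close> K by (simp add: \<rho>_def)
  define c where "c = sqrt (1 - (\<gamma> / K)\<^sup>2)"
  have c: "0 \<le> c" "c < 1" "c\<^sup>2 = 1 - (\<gamma> / K)\<^sup>2"
    using \<open>0 < \<gamma>\<close> K by (auto simp: c_def power_le_one_iff)
  have contraction: "norm (u - \<rho> *\<^sub>R D u) \<le> c * norm u" if u: "u \<in> Y" for u
  proof -
    have "ip u (D u) = of_real (q u)"
      using ip_conj[of u "D u"] real[OF u] by simp
    then have "(of_real ((norm (u - \<rho> *\<^sub>R D u))\<^sup>2) :: 'k)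
        = of_real ((norm u)\<^sup>2 - 2 * \<rho> * q u + (\<rho> * norm (D u))\<^sup>2)"
      using real[OF u] \<open>0 < \<rho>\<close> unfolding norm_diff_squared smul_of_real[symmetric] ip_smul_left ip_smul_right
      by (simp add: norm_smul algebra_simps)
    then have "(norm (u - \<rho> *\<^sub>R D u))\<^sup>2 = (norm u)\<^sup>2 - 2 * \<rho> * q u + (\<rho> * norm (D u))\<^sup>2"
      by (simp only: of_real_eq_iff)
    also have "\<dots> \<le> (norm u)\<^sup>2 - 2 * \<rho> * (\<gamma> * (norm u)\<^sup>2) + (\<rho> * (K * norm u))\<^sup>2"
      using coercive[OF u] K_bound[OF u] \<open>0 < \<rho>\<close>
      by (intro add_mono diff_mono mult_left_mono power_mono) auto
    also have "\<dots> = (c * norm u)\<^sup>2"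
      using K(1) unfolding power_mult_distrib c(3) \<rho>_def
      by (simp add: power2_eq_square field_simps)
    finally show ?thesis
      by (rule power2_le_imp_le) (use c(1) in simp)
  qed
  have "z \<in> D ` Y" if "z \<in> Y" for z
  proof -
    define G where "G y = y - \<rho> *\<^sub>R (D y - z)" for y
    have "\<exists>!y\<in>Y. G y = y"
    proof (rule Banach_fix[OF _ _ c(1,2)])
      show "complete Y" using S(2) by (simp add: complete_eq_closed)
      show "Y \<noteq> {}" using that by blast
      show "G ` Y \<subseteq> Y"
        unfolding G_def using S(1) that bounded_operator_in[OF D]
        by (auto intro!: subspace_diff subspace_scale simp flip: smul_of_real)
      show "dist (G x) (G y) \<le> c * dist x y" if "x \<in> Y" "y \<in> Y" for x y
      proof -
        have "G x - G y = (x - y) - \<rho> *\<^sub>R D (x - y)"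
          unfolding G_def by (simp add: bounded_operator_diff[OF Y D that] algebra_simps)
        then show ?thesis
          using contraction[of "x - y"] that S(1) by (simp add: dist_norm subspace_diff)
      qed
    qed
    then obtain y where "y \<in> Y" "G y = y" by blast
    with \<open>0 < \<rho>\<close> show ?thesis unfolding G_def by auto
  qed
  then show "D ` Y = Y"
    using bounded_operator_in[OF D] by blast
qed


section \<open>The Laplacian of two consecutive maps\<close>

definition laplacian :: "'a set \<Rightarrow> 'a set \<Rightarrow> 'a set \<Rightarrow> ('a \<Rightarrow> 'a) \<Rightarrow> ('a \<Rightarrow> 'a) \<Rightarrow> 'a \<Rightarrow> 'a"
  where "laplacian X Y Z a b =
    (\<lambda>x. a (hilbert_adjoint ip X Y a x) + hilbert_adjoint ip Y Z b (b x))"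

lemma bounded_operator_laplacian:
  assumes X: "closed_subspace smul X" and Y: "closed_subspace smul Y"
    and a: "bounded_operator smul X Y a" and b: "bounded_operator smul Y Z b"
  shows "bounded_operator smul Y Y (laplacian X Y Z a b)"
  unfolding laplacian_def
  using Y bounded_operator_compose[OF a bounded_operator_hilbert_adjoint[OF X a]]
    bounded_operator_compose[OF bounded_operator_hilbert_adjoint[OF Y b] b]
  by (intro bounded_operator_sum) (auto simp: closed_subspace_def)

lemma ip_laplacian:
  assumes X: "closed_subspace smul X" and Y: "closed_subspace smul Y"
    and a: "bounded_operator smul X Y a" and b: "bounded_operator smul Y Z b"
    and "x \<in> Y" "y \<in> Y"
  shows "ip (laplacian X Y Z a b x) y =
    ip (hilbert_adjoint ip X Y a x) (hilbert_adjoint ip X Y a y) + ip (b x) (b y)"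
  using assms(5,6) unfolding laplacian_def ip_add_left
  by (simp add: ip_hilbert_adjoint[OF X a] hilbert_adjoint_in[OF X a] ip_hilbert_adjoint_left[OF Y b])

lemma self_adjoint_laplacian:
  assumes X: "closed_subspace smul X" and Y: "closed_subspace smul Y"
    and a: "bounded_operator smul X Y a" and b: "bounded_operator smul Y Z b"
  shows "self_adjoint_operator ip Y (laplacian X Y Z a b)"
  unfolding self_adjoint_operator_def
proof
  fix y assume y: "y \<in> Y"
  note A = bounded_operator_laplacian[OF assms]
  show "hilbert_adjoint ip Y Y (laplacian X Y Z a b) y = laplacian X Y Z a b y"
  proof (rule hilbert_adjoint_eqI[OF Y A])
    show "laplacian X Y Z a b y \<in> Y" using A y by (rule bounded_operator_in)
    show "ip (laplacian X Y Z a b x) y = ip x (laplacian X Y Z a b y)" if "x \<in> Y" for x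
      unfolding ip_conj[of x "laplacian X Y Z a b y"] ip_laplacian[OF assms that y]
        ip_laplacian[OF assms y that] conj_add ip_conj[symmetric] ..
  qed
qed

lemma ip_sum_left: "ip (\<Sum>f\<in>F. g f) y = (\<Sum>f\<in>F. ip (g f) y)"
  by (induction F rule: infinite_finite_induct) (auto simp: ip_add_left)

lemma weakly_bounded_on_span:
  assumes "\<And>z. z \<in> G \<Longrightarrow> \<exists>B. \<forall>y\<in>S. norm (ip y z) \<le> B" and "z \<in> span G"
  shows "\<exists>B. \<forall>y\<in>S. norm (ip y z) \<le> B"
proof -
  let ?W = "{z. \<exists>B. \<forall>y\<in>S. norm (ip y z) \<le> B}"
  have "subspace ?W"
  proof (rule subspaceI)
    show "0 \<in> ?W" by auto
    show "x + x' \<in> ?W" if x: "x \<in> ?W" "x' \<in> ?W" for x x'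
    proof -
      obtain B B' where "\<forall>y\<in>S. norm (ip y x) \<le> B" "\<forall>y\<in>S. norm (ip y x') \<le> B'"
        using x by blast
      then have "\<forall>y\<in>S. norm (ip y (x + x')) \<le> B + B'"
        by (auto simp: ip_add_right intro!: norm_triangle_mono)
      then show ?thesis by blast
    qed
    show "smul c x \<in> ?W" if x: "x \<in> ?W" for c x
    proof -
      obtain B where "\<forall>y\<in>S. norm (ip y x) \<le> B" using x by blast
      then have "\<forall>y\<in>S. norm (ip y (smul c x)) \<le> norm c * B"
        by (auto simp: ip_smul_right norm_mult intro!: mult_left_mono)
      then show ?thesis by blast
    qed
  qed
  moreover have "G \<subseteq> ?W" using assms(1) by blast
  ultimately have "span G \<subseteq> ?W" by (intro span_minimal)
  with assms(2) show ?thesis by blast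
qed

text \<open>
  The functional \<open>q\<close> is the quadratic form of the Laplacian plus a form of finite rank. On the set
  where \<open>q \<le> 1\<close> the three kinds of generators of \<open>Y\<close> have bounded inner products: for instance
  \<open>ip y (a u) = ip (a\<^sup>* y) u\<close> has norm at most \<open>norm u\<close>. So the set is weakly bounded, hence bounded,
  which by homogeneity of \<open>q\<close> is coercivity.
\<close>

lemma laplacian_coercive_modulo_finite_rank:
  assumes X: "closed_subspace smul X" and Y: "closed_subspace smul Y"
    and a: "bounded_operator smul X Y a" and b: "bounded_operator smul Y Z b"
    and F: "finite F" "F \<subseteq> Y"
    and span: "Y \<subseteq> span (a ` X \<union> hilbert_adjoint ip Y Z b ` Z \<union> F)"
  defines "q \<equiv> \<lambda>y. (norm (hilbert_adjoint ip X Y a y))\<^sup>2 + (norm (b y))\<^sup>2 + (\<Sum>f\<in>F. (norm (ip y f))\<^sup>2)"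
  shows "\<exists>\<gamma>>0. \<forall>y\<in>Y. \<gamma> * (norm y)\<^sup>2 \<le> q y"
proof -
  let ?a = "hilbert_adjoint ip X Y a" and ?b = "hilbert_adjoint ip Y Z b"
  have a': "bounded_operator smul Y X ?a" using X a by (rule bounded_operator_hilbert_adjoint)
  define S where "S = {y \<in> Y. q y \<le> 1}"
  have S: "norm (?a y) \<le> 1" "norm (b y) \<le> 1" "f \<in> F \<Longrightarrow> norm (ip y f) \<le> 1" if "y \<in> S" for y f
  proof -
    have sum: "0 \<le> (\<Sum>f\<in>F. (norm (ip y f))\<^sup>2)" by (intro sum_nonneg) auto
    have q: "q y \<le> 1" using that unfolding S_def by blast
    have "(norm (?a y))\<^sup>2 \<le> 1\<^sup>2"
      using q sum zero_le_power2[of "norm (b y)"] unfolding q_def one_power2 by linarith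
    then show "norm (?a y) \<le> 1" by (rule power2_le_imp_le) simp
    have "(norm (b y))\<^sup>2 \<le> 1\<^sup>2"
      using q sum zero_le_power2[of "norm (?a y)"] unfolding q_def one_power2 by linarith
    then show "norm (b y) \<le> 1" by (rule power2_le_imp_le) simp
    show "norm (ip y f) \<le> 1" if "f \<in> F"
    proof -
      have "(norm (ip y f))\<^sup>2 \<le> (\<Sum>f\<in>F. (norm (ip y f))\<^sup>2)"
        using F(1) that by (intro member_le_sum) auto
      then have "(norm (ip y f))\<^sup>2 \<le> 1\<^sup>2"
        using q zero_le_power2[of "norm (b y)"] zero_le_power2[of "norm (?a y)"]
        unfolding q_def one_power2 by linarith
      then show ?thesis by (rule power2_le_imp_le) simp
    qed
  qed
  have "\<exists>B. \<forall>y\<in>S. norm (ip y z) \<le> B" if "z \<in> a ` X \<union> ?b ` Z \<union> F" for z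
  proof -
    from that have "(\<exists>u. z = a u \<and> u \<in> X) \<or> (\<exists>v. z = ?b v) \<or> z \<in> F" by blast
    then consider u where "u \<in> X" "z = a u" | v where "z = ?b v" | "z \<in> F" by blast
    then show ?thesis
    proof cases
      case 1
      have "norm (ip y z) \<le> norm u" if "y \<in> S" for y
      proof -
        have "ip y z = ip (?a y) u"
          using 1 ip_hilbert_adjoint_left[OF X a] by simp
        also have "norm \<dots> \<le> norm (?a y) * norm u"
          by (rule Cauchy_Schwarz)
        also have "\<dots> \<le> 1 * norm u"
          using S[OF that] by (intro mult_right_mono) auto
        finally show ?thesis by simp
      qed
      then show ?thesis by blast
    next
      case 2
      have "norm (ip y z) \<le> norm v" if "y \<in> S" for y
      proof -
        have "ip y z = ip (b y) v"
          using 2 ip_hilbert_adjoint[OF Y b, of y v] that unfolding S_def by simp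
        also have "norm \<dots> \<le> norm (b y) * norm v"
          by (rule Cauchy_Schwarz)
        also have "\<dots> \<le> 1 * norm v"
          using S[OF that] by (intro mult_right_mono) auto
        finally show ?thesis by simp
      qed
      then show ?thesis by blast
    next
      case 3
      with S show ?thesis by blast
    qed
  qed
  then have on_Y: "\<exists>B. \<forall>y\<in>S. norm (ip y z) \<le> B" if "z \<in> Y" for z
    using weakly_bounded_on_span[of "a ` X \<union> ?b ` Z \<union> F" S z] span that by blast
  have "\<exists>B. \<forall>y\<in>S. norm (ip y z) \<le> B" for z
  proof -
    have "ip y z = ip y (proj Y z)" if "y \<in> S" for y
    proof -
      have "ip y (z - proj Y z) = 0"
        using ip_proj_residual[OF Y, of y z] that ip_eq_0_commute unfolding S_def by blast
      then show ?thesis by (simp add: ip_diff_right)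
    qed
    with on_Y[OF proj_in[OF Y]] show ?thesis by simp
  qed
  then obtain B0 where B0: "\<And>y. y \<in> S \<Longrightarrow> norm y \<le> B0"
    by (rule uniform_boundedness) blast
  \<comment> \<open>A strict bound, so that a vector of S scaled to have norm B is a contradiction.\<close>
  define B where "B = max B0 0 + 1"
  have B: "0 < B" "\<And>y. y \<in> S \<Longrightarrow> norm y < B"
    using B0 unfolding B_def by fastforce+
  have "(1 / B\<^sup>2) * (norm y)\<^sup>2 \<le> q y" if y: "y \<in> Y" for y
  proof (rule ccontr)
    assume less: "\<not> (1 / B\<^sup>2) * (norm y)\<^sup>2 \<le> q y"
    have "0 \<le> q y" unfolding q_def by (intro add_nonneg_nonneg sum_nonneg) auto
    with less have "y \<noteq> 0" by auto
    define t where "t = B / norm y"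
    have "0 < t" using B(1) \<open>y \<noteq> 0\<close> by (simp add: t_def)
    have "q (smul (of_real t) y) = t\<^sup>2 * q y"
      unfolding q_def
      by (simp add: bounded_operator_smul[OF a' y] bounded_operator_smul[OF b y] ip_smul_left
          norm_smul norm_mult power_mult_distrib distrib_left sum_distrib_left)
    also have "\<dots> \<le> t\<^sup>2 * ((1 / B\<^sup>2) * (norm y)\<^sup>2)"
      using less by (intro mult_left_mono) auto
    also have "\<dots> = 1"
      using B(1) \<open>y \<noteq> 0\<close> by (simp add: t_def power_divide)
    finally have "smul (of_real t) y \<in> S"
      using Y y unfolding S_def by (simp add: closed_subspace_def subspace_scale)
    moreover have "norm (smul (of_real t) y) = B"
      using B(1) \<open>y \<noteq> 0\<close> by (simp add: norm_smul t_def norm_divide)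
    ultimately show False using B(2) by fastforce
  qed
  with B(1) show ?thesis by (intro exI[of _ "1 / B\<^sup>2"]) auto
qed

text \<open>
  The Laplacian differs from a coercive, hence bijective, operator \<open>D\<close> by an operator \<open>K\<close> with
  values in the span of a finite set. So its range misses at most that span, and \<open>D\<close> maps its null
  space injectively into that span.
\<close>

lemma laplacian_almost_bijective:
  assumes X: "closed_subspace smul X" and Y: "closed_subspace smul Y"
    and a: "bounded_operator smul X Y a" and b: "bounded_operator smul Y Z b"
    and ranges: "Y \<preceq> a ` X \<union> hilbert_adjoint ip Y Z b ` Z"
  shows "Y \<preceq> laplacian X Y Z a b ` Y" and "null_space Y (laplacian X Y Z a b) \<preceq> {0}"
proof -
  let ?A = "laplacian X Y Z a b"
  have SY: "subspace Y" using Y unfolding closed_subspace_def by blast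
  obtain F where F: "finite F" "F \<subseteq> Y"
    and span: "Y \<subseteq> span (a ` X \<union> hilbert_adjoint ip Y Z b ` Z \<union> F)"
    using ranges by (rule almost_subset_obtain_generators)
  define q where "q y = (norm (hilbert_adjoint ip X Y a y))\<^sup>2 + (norm (b y))\<^sup>2 + (\<Sum>f\<in>F. (norm (ip y f))\<^sup>2)" for y
  obtain \<gamma> where \<gamma>: "0 < \<gamma>" "\<And>y. y \<in> Y \<Longrightarrow> \<gamma> * (norm y)\<^sup>2 \<le> q y"
    using laplacian_coercive_modulo_finite_rank[OF X Y a b F span] unfolding q_def by blast
  define K where "K y = (\<Sum>f\<in>F. smul (ip y f) f)" for y
  have K_span: "K y \<in> span F" for y
    unfolding K_def by (intro span_sum span_scale span_base)
  have K: "bounded_operator smul Y Y K"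
  proof (rule bounded_operatorI[where K = "\<Sum>f\<in>F. norm f * norm f"])
    show "K y \<in> Y" for y
      using K_span[of y] span_minimal[OF F(2) SY] by blast
    show "K (x + y) = K x + K y" for x y
      unfolding K_def by (simp add: ip_add_left scale_left_distrib sum.distrib)
    show "K (smul c y) = smul c (K y)" for c y
      unfolding K_def by (simp add: ip_smul_left scale_sum_right)
    show "norm (K y) \<le> (\<Sum>f\<in>F. norm f * norm f) * norm y" for y
    proof -
      have "norm (K y) \<le> (\<Sum>f\<in>F. norm (ip y f) * norm f)"
        unfolding K_def using norm_sum[of "\<lambda>f. smul (ip y f) f" F] by (simp add: norm_smul)
      also have "\<dots> \<le> (\<Sum>f\<in>F. (norm y * norm f) * norm f)"
        by (intro sum_mono mult_right_mono Cauchy_Schwarz) auto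
      finally show ?thesis unfolding sum_distrib_right by (simp add: mult_ac)
    qed
  qed
  define D where "D y = ?A y + K y" for y
  note A = bounded_operator_laplacian[OF X Y a b]
  have D: "bounded_operator smul Y Y D"
    unfolding D_def using SY A K by (rule bounded_operator_sum)
  have form: "ip (D y) y = of_real (q y)" if "y \<in> Y" for y
  proof -
    have "ip (K y) y = (\<Sum>f\<in>F. ip y f * conj (ip y f))"
      unfolding K_def ip_sum_left ip_smul_left by (intro sum.cong refl) (metis ip_conj)
    also have "\<dots> = of_real (\<Sum>f\<in>F. (norm (ip y f))\<^sup>2)"
      by (simp add: mult_conj scaleR_conv_of_real)
    finally show ?thesis
      unfolding D_def q_def ip_add_left ip_laplacian[OF X Y a b that that] ip_self of_real_add by simp
  qed
  note D_bij = coercive_bijective[OF Y D \<gamma>(1) form \<gamma>(2)]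
  have "Y \<subseteq> span (?A ` Y \<union> F)"
  proof
    fix y assume "y \<in> Y"
    then obtain x where "x \<in> Y" "y = ?A x + K x"
      using D_bij(1) unfolding D_def by blast
    moreover have "?A x \<in> span (?A ` Y)" if "x \<in> Y" using that by (intro span_base) blast
    ultimately show "y \<in> span (?A ` Y \<union> F)"
      unfolding span_Un using K_span by blast
  qed
  with F(1) show "Y \<preceq> ?A ` Y"
    unfolding almost_subset_def by blast
  let ?N = "null_space Y ?A" and ?D = "\<lambda>y. D (proj Y y)"
  have hom: "module_hom smul smul ?D"
    using Y D by (rule module_hom_compose_proj)
  have sub: "?N \<subseteq> Y" unfolding null_space_def by blast
  have SN: "subspace ?N"
    using closed_subspace_null_space[OF Y A] unfolding closed_subspace_def by blast
  have "D y \<in> span F" if "y \<in> ?N" for y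
    using that K_span[of y] unfolding D_def null_space_def by simp
  then have "?D ` ?N \<subseteq> span F"
    unfolding image_compose_proj[OF Y sub] by (rule image_subsetI)
  also have "span F \<subseteq> span (?D ` {0} \<union> F)"
    by (rule span_mono) blast
  finally have "?D ` ?N \<preceq> ?D ` {0}"
    using F(1) unfolding almost_subset_def by blast
  then have "?N \<preceq> {0} \<union> {y \<in> ?N. ?D y = 0}"
    using subspace_0[OF SN] by (intro almost_subset_vimage[OF hom SN]) auto
  moreover have "{0} \<union> {y \<in> ?N. ?D y = 0} \<subseteq> {0}"
    using D_bij(2) sub by (auto simp: proj_id[OF Y] subset_iff)
  ultimately show "?N \<preceq> {0}"
    by (rule almost_subset_mono[OF _ subset_refl])
qed

lemma fredholm_laplacian_iff:
  assumes X: "closed_subspace smul X" and Y: "closed_subspace smul Y"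
    and a: "bounded_operator smul X Y a" and b: "bounded_operator smul Y Z b"
  shows "fredholm_operator smul Y Y (laplacian X Y Z a b)
    \<longleftrightarrow> Y \<preceq> a ` X \<union> hilbert_adjoint ip Y Z b ` Z"
proof -
  let ?A = "laplacian X Y Z a b"
  note A = bounded_operator_laplacian[OF X Y a b]
  have "?A ` Y \<subseteq> Y" using bounded_operator_in[OF A] by blast
  then have cap: "Y \<inter> ?A ` Y = ?A ` Y" by blast
  have SY: "subspace Y" using Y unfolding closed_subspace_def by blast
  have quotient: "finite_dim_quotient smul Y (?A ` Y) \<longleftrightarrow> Y \<preceq> ?A ` Y"
    using finite_dim_quotient_iff_almost_subset[OF SY subspace_bounded_operator_image[OF Y A]]
    unfolding cap .
  show ?thesis
  proof
    assume "fredholm_operator smul Y Y ?A"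
    then have "Y \<preceq> ?A ` Y" unfolding fredholm_operator_def quotient by blast
    moreover have "?A ` Y \<subseteq> span (a ` X \<union> hilbert_adjoint ip Y Z b ` Z)"
    proof
      fix w assume "w \<in> ?A ` Y"
      then obtain y where "y \<in> Y" and w: "w = a (hilbert_adjoint ip X Y a y) + hilbert_adjoint ip Y Z b (b y)"
        unfolding laplacian_def by blast
      then show "w \<in> span (a ` X \<union> hilbert_adjoint ip Y Z b ` Z)"
        unfolding w using hilbert_adjoint_in[OF X a, of y] bounded_operator_in[OF b, of y]
        by (intro span_add span_base) auto
    qed
    ultimately show "Y \<preceq> a ` X \<union> hilbert_adjoint ip Y Z b ` Z"
      using almost_subset_trans almost_subset_if_subset_span by blast
  next
    assume "Y \<preceq> a ` X \<union> hilbert_adjoint ip Y Z b ` Z"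
    from laplacian_almost_bijective[OF assms this] A show "fredholm_operator smul Y Y ?A"
      unfolding fredholm_operator_def quotient finite_dim_iff_almost_subset by blast
  qed
qed

section \<open>Consecutive maps with composition of finite rank\<close>

text \<open>
  The projection moves a vector by its residual, and the residual map kills \<open>M\<close>; so the residuals
  of \<open>V\<close> form a finite dimensional set.
\<close>

lemma proj_image_almost_subset:
  assumes M: "closed_subspace smul M" and V: "V \<preceq> M"
  shows "proj M ` V \<preceq> V"
proof -
  let ?Q = "\<lambda>x. x - proj M x"
  note hom = module_hom_proj[OF M]
  have homQ: "module_hom smul smul ?Q"
    by (rule module_hom_smulI)
      (simp_all add: module_hom.add[OF hom] module_hom.scale[OF hom] scale_right_diff_distrib)
  have "?Q ` V \<preceq> ?Q ` M"
    using homQ V by (rule almost_subset_image)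
  moreover have "?Q ` M \<subseteq> span V"
    by (auto simp: proj_id[OF M] span_zero)
  ultimately have Q: "?Q ` V \<preceq> V"
    by (rule almost_subset_trans[OF _ almost_subset_if_subset_span])
  have "V \<union> ?Q ` V \<preceq> V"
    using almost_subset_if_subset_span[OF span_superset] Q by (rule almost_subset_Un)
  moreover have "proj M ` V \<preceq> V \<union> ?Q ` V"
  proof (rule almost_subset_if_subset_span, rule subsetI)
    fix w assume "w \<in> proj M ` V"
    then obtain y where y: "y \<in> V" "w = y - ?Q y" by auto
    then show "w \<in> span (V \<union> ?Q ` V)"
      unfolding y(2) by (intro span_diff span_base) auto
  qed
  ultimately show ?thesis by (rule almost_subset_trans[rotated])
qed

lemma almost_subset_proj_image:
  assumes M: "closed_subspace smul M" "M \<subseteq> Y" and "Y \<preceq> W"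
  shows "M \<preceq> proj M ` W"
proof (rule almost_subset_mono[OF almost_subset_image[OF module_hom_proj[OF M(1)] assms(3)] _ subset_refl])
  have "M = proj M ` M" using proj_id[OF M(1)] by simp
  with M(2) show "M \<subseteq> proj M ` Y" by blast
qed

lemma range_almost_subset_null_space:
  assumes X: "closed_subspace smul X" and Y: "closed_subspace smul Y"
    and a: "bounded_operator smul X Y a" and b: "bounded_operator smul Y Z b"
    and ba: "finite_dim smul ((b \<circ> a) ` X)"
  shows "a ` X \<preceq> null_space Y b"
proof -
  let ?b = "\<lambda>y. b (proj Y y)"
  have hom: "module_hom smul smul ?b" using Y b by (rule module_hom_compose_proj)
  have sub: "a ` X \<subseteq> Y" using bounded_operator_in[OF a] by blast
  have R: "subspace (a ` X)" using X a by (rule subspace_bounded_operator_image)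
  have "(b \<circ> a) ` X \<preceq> {0}" using ba unfolding finite_dim_iff_almost_subset .
  then have "?b ` a ` X \<preceq> ?b ` {0}"
    unfolding image_compose_proj[OF Y sub] using module_hom.zero[OF hom] by (simp add: image_comp)
  then have "a ` X \<preceq> {0} \<union> {y \<in> a ` X. ?b y = 0}"
    using subspace_0[OF R] by (intro almost_subset_vimage[OF hom R]) auto
  moreover have "{0} \<union> {y \<in> a ` X. ?b y = 0} \<subseteq> null_space Y b"
    using sub subspace_0[OF R] bounded_operator_zero[OF Y b]
    unfolding null_space_def by (auto simp: proj_id[OF Y] subset_iff)
  ultimately show ?thesis by (rule almost_subset_mono[OF _ subset_refl])
qed

text \<open>
  Project the hypothesis \<open>ranges\<close> to the null space \<open>N\<close> of \<open>b\<close>. This kills the range of the adjoint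
  of \<open>b\<close>, and moves the range of \<open>a\<close>, which \<open>N\<close> almost contains, only by finitely many dimensions.
\<close>

lemma null_space_almost_subset_range:
  assumes X: "closed_subspace smul X" and Y: "closed_subspace smul Y"
    and a: "bounded_operator smul X Y a" and b: "bounded_operator smul Y Z b"
    and ba: "finite_dim smul ((b \<circ> a) ` X)"
    and ranges: "Y \<preceq> a ` X \<union> hilbert_adjoint ip Y Z b ` Z"
  shows "null_space Y b \<preceq> a ` X"
proof -
  define N where "N = null_space Y b"
  have N: "closed_subspace smul N" unfolding N_def using Y b by (rule closed_subspace_null_space)
  have "N \<preceq> proj N ` (a ` X \<union> hilbert_adjoint ip Y Z b ` Z)"
    using N _ ranges by (rule almost_subset_proj_image) (auto simp: N_def null_space_def)
  moreover have "proj N ` (hilbert_adjoint ip Y Z b ` Z) \<subseteq> {0}"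
  proof -
    have "proj N (hilbert_adjoint ip Y Z b z) = 0" for z
    proof (rule proj_eq_0[OF N])
      fix x assume "x \<in> N"
      then show "ip (hilbert_adjoint ip Y Z b z) x = 0"
        unfolding N_def null_space_def by (simp add: ip_hilbert_adjoint_left[OF Y b])
    qed
    then show ?thesis by blast
  qed
  then have "proj N ` (hilbert_adjoint ip Y Z b ` Z) \<preceq> a ` X"
    by (rule almost_subset_if_subset_zero)
  moreover have "proj N ` a ` X \<preceq> a ` X"
    using range_almost_subset_null_space[OF X Y a b ba]
    by (intro proj_image_almost_subset N) (simp add: N_def)
  ultimately have "N \<preceq> proj N ` (a ` X \<union> hilbert_adjoint ip Y Z b ` Z)"
    and "proj N ` (a ` X \<union> hilbert_adjoint ip Y Z b ` Z) \<preceq> a ` X"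
    unfolding image_Un by (auto intro: almost_subset_Un)
  then show ?thesis
    unfolding N_def[symmetric] by (rule almost_subset_trans)
qed

text \<open>
  The induction step, from \<open>Z\<close> to \<open>Y\<close>. The range of \<open>b\<close> is almost contained in the null space \<open>M\<close> of
  \<open>c\<close>, and \<open>M\<close> is almost contained in the projection to \<open>M\<close> of the range of the Laplacian
  \<open>b b\<^sup>* + c\<^sup>* c\<close>. The summand \<open>c\<^sup>* c\<close> projects to zero, and projecting the range of \<open>b b\<^sup>*\<close> changes
  only finitely many dimensions. So the range of \<open>b\<close> is almost contained in that of \<open>b b\<^sup>*\<close>,
  and pulling back along \<open>b\<close> gives the claim.
\<close>

lemma almost_spanned_by_ranges:
  assumes Y: "closed_subspace smul Y" and Z: "closed_subspace smul Z"
    and b: "bounded_operator smul Y Z b"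
    and c: "bounded_operator smul Z W c"
    and cb: "finite_dim smul ((c \<circ> b) ` Y)"
    and below: "Z \<preceq> b ` Y \<union> hilbert_adjoint ip Z W c ` W"
    and exact: "null_space Y b \<preceq> a ` X"
  shows "Y \<preceq> a ` X \<union> hilbert_adjoint ip Y Z b ` Z"
proof -
  let ?b = "hilbert_adjoint ip Y Z b" and ?A = "laplacian Y Z W b c"
  let ?R = "b ` ?b ` Z"
  define M where "M = null_space Z c"
  have M: "closed_subspace smul M" unfolding M_def using Z c by (rule closed_subspace_null_space)
  have hom: "module_hom smul smul (proj M)" using M by (rule module_hom_proj)
  have SY: "subspace Y" using Y unfolding closed_subspace_def by blast
  have b': "?b ` Z \<subseteq> Y" using hilbert_adjoint_in[OF Y b] by blast
  then have R_sub: "?R \<subseteq> b ` Y" by blast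
  have bY_M: "b ` Y \<preceq> M"
    unfolding M_def using Y Z b c cb by (rule range_almost_subset_null_space)
  have "M \<preceq> proj M ` ?A ` Z"
    using M _ laplacian_almost_bijective(1)[OF Y Z b c below]
    by (rule almost_subset_proj_image) (auto simp: M_def null_space_def)
  moreover have "proj M ` ?A ` Z \<subseteq> proj M ` ?R"
  proof -
    have "proj M (?A z) = proj M (b (?b z))" for z
    proof -
      have "proj M (hilbert_adjoint ip Z W c (c z)) = 0"
      proof (rule proj_eq_0[OF M])
        fix x assume "x \<in> M"
        then show "ip (hilbert_adjoint ip Z W c (c z)) x = 0"
          unfolding M_def null_space_def by (simp add: ip_hilbert_adjoint_left[OF Z c])
      qed
      then show ?thesis
        unfolding laplacian_def by (simp add: module_hom.add[OF hom])
    qed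
    then show ?thesis by auto
  qed
  ultimately have "M \<preceq> proj M ` ?R"
    by (rule almost_subset_mono[OF _ subset_refl])
  moreover have "proj M ` ?R \<preceq> ?R"
    using M almost_subset_mono[OF bY_M R_sub subset_refl] by (rule proj_image_almost_subset)
  ultimately have "b ` Y \<preceq> b ` ?b ` Z"
    using bY_M almost_subset_trans[of "b ` Y" M] almost_subset_trans[of M "proj M ` ?R" ?R] by simp
  then have "Y \<preceq> ?b ` Z \<union> {y \<in> Y. b (proj Y y) = 0}"
    using almost_subset_vimage[OF module_hom_compose_proj[OF Y b] SY b']
    by (simp only: image_compose_proj[OF Y b'] image_compose_proj[OF Y subset_refl])
  moreover have "{y \<in> Y. b (proj Y y) = 0} = null_space Y b"
    unfolding null_space_def using proj_id[OF Y] by auto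
  moreover have "?b ` Z \<union> null_space Y b \<preceq> a ` X \<union> ?b ` Z"
  proof (rule almost_subset_Un)
    show "?b ` Z \<preceq> a ` X \<union> ?b ` Z"
      by (intro almost_subset_if_subset_span order_trans[OF _ span_superset]) blast
    show "null_space Y b \<preceq> a ` X \<union> ?b ` Z"
      using exact by (rule almost_subset_mono) auto
  qed
  ultimately show ?thesis
    using almost_subset_trans[of Y "?b ` Z \<union> null_space Y b" "a ` X \<union> ?b ` Z"] by simp
qed

end

theorem theorem6p1:
  fixes smul :: "'k::conj_field \<Rightarrow> 'a::banach \<Rightarrow> 'a"
    and ip :: "'a \<Rightarrow> 'a \<Rightarrow> 'k"
    and n :: nat
    and H :: "int \<Rightarrow> 'a set"
    and \<delta> :: "int \<Rightarrow> 'a \<Rightarrow> 'a"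
  assumes "hilbert_space smul ip"
    and "spaces_and_maps smul n H \<delta>"
    and "\<And>p. finite_dim smul ((\<delta> p \<circ> \<delta> (p + 1)) ` H (p + 1))"
  shows "fredholm_chain smul n H \<delta> \<longleftrightarrow>
    (\<forall>p. let A = (\<lambda>x. \<delta> (p + 1) (hilbert_adjoint ip (H (p + 1)) (H p) (\<delta> (p + 1)) x)
                    + hilbert_adjoint ip (H p) (H (p - 1)) (\<delta> p) (\<delta> p x))
         in fredholm_operator smul (H p) (H p) A \<and> self_adjoint_operator ip (H p) A)"
proof -
  interpret hilbert_space smul ip by fact
  have H: "closed_subspace smul (H p)" and \<delta>: "bounded_operator smul (H p) (H (p - 1)) (\<delta> p)"
    and outside: "p < 0 \<or> p \<ge> int n + 1 \<Longrightarrow> H p = {0}" for p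
    using assms(2) unfolding spaces_and_maps_def by blast+
  have \<delta>': "bounded_operator smul (H (p + 1)) (H p) (\<delta> (p + 1))" for p
    using \<delta>[of "p + 1"] by simp
  have trivial: "V \<preceq> W" if "p < 0 \<or> p \<ge> int n + 1" "V \<subseteq> H p" for p V W
    using that(2) unfolding outside[OF that(1)] by (rule almost_subset_if_subset_zero)
  have range_null: "\<delta> (p + 1) ` H (p + 1) \<preceq> null_space (H p) (\<delta> p)" for p
    using H H \<delta>' \<delta> assms(3) by (rule range_almost_subset_null_space)
  define spanned where "spanned p \<longleftrightarrow>
    H p \<preceq> \<delta> (p + 1) ` H (p + 1) \<union> hilbert_adjoint ip (H p) (H (p - 1)) (\<delta> p) ` H (p - 1)" for p
  have sub: "subspace (null_space (H p) (\<delta> p))" "subspace (\<delta> (p + 1) ` H (p + 1))" for p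
    using closed_subspace_null_space[OF H \<delta>] subspace_bounded_operator_image[OF H \<delta>']
    unfolding closed_subspace_def by auto
  have chain: "fredholm_chain smul n H \<delta> \<longleftrightarrow>
      (\<forall>p\<in>{0..int n}. null_space (H p) (\<delta> p) \<preceq> \<delta> (p + 1) ` H (p + 1))"
    unfolding fredholm_chain_def Let_def
    using assms(2) range_null finite_dim_quotient_iff_almost_subset[OF sub]
      finite_dim_quotient_iff_almost_subset[OF sub(2,1)]
    by (simp add: Int_commute)
  also have "\<dots> \<longleftrightarrow> (\<forall>p. spanned p)"
  proof
    assume exact: "\<forall>p\<in>{0..int n}. null_space (H p) (\<delta> p) \<preceq> \<delta> (p + 1) ` H (p + 1)"
    have exact': "null_space (H p) (\<delta> p) \<preceq> \<delta> (p + 1) ` H (p + 1)" for p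
    proof (cases "p \<in> {0..int n}")
      case True
      with exact show ?thesis by blast
    next
      case False
      then show ?thesis by (intro trivial[of p]) (auto simp: null_space_def)
    qed
    have step: "spanned (p + 1)" if "spanned p" for p
      using almost_spanned_by_ranges[OF H H \<delta>' \<delta> assms(3) that[unfolded spanned_def] exact']
      unfolding spanned_def by simp
    have base: "spanned p" if "p < 0" for p
      unfolding spanned_def using that by (intro trivial[of p]) auto
    have "spanned p" if "- 1 \<le> p" for p
      using that by (induction p rule: int_ge_induct) (simp_all add: base step)
    moreover have "p < 0 \<or> - 1 \<le> p" for p :: int by linarith
    ultimately show "\<forall>p. spanned p" using base by blast
  next
    assume "\<forall>p. spanned p"
    then show "\<forall>p\<in>{0..int n}. null_space (H p) (\<delta> p) \<preceq> \<delta> (p + 1) ` H (p + 1)"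
      unfolding spanned_def
      using null_space_almost_subset_range[OF H H \<delta>' \<delta> assms(3)] by blast
  qed
  finally show ?thesis
    unfolding spanned_def Let_def laplacian_def[symmetric]
    using fredholm_laplacian_iff[OF H H \<delta>' \<delta>] self_adjoint_laplacian[OF H H \<delta>' \<delta>] by simp
qed

end
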